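(* There is an absolute constant $C>0$ such that for all integers $n\ge1$ and $T\ge2$ there exists a principal-agent problem $(\mathbf c,\mathbf F,\mathbf r)$ with $T+1$ types, $n+1$ actions, and four outcomes, with $\mathrm{OptTypeAware}(\mathbf c,\mathbf F,\mathbf r)>0$, that satisfies $$\mathrm{OptMenu}(\mathbf c,\mathbf F,\mathbf r)\ \le\ \frac{C}{n\log T}\,\mathrm{OptTypeAware}(\mathbf c,\mathbf F,\mathbf r).$$
   Context: A (typed) principal-agent problem $(\mathbf c,\mathbf F,\mathbf r)$ with $N$ actions, $m$ outcomes and $K$ types consists of: costs $\mathbf c\in\mathbb R_{\ge 0}^N$ (the same for all types), where some action has cost $0$; rewards $\mathbf r\in\mathbb R_{\ge0}^m$, where some outcome has reward $0$ (the ordering of actions and outcomes is immaterial); and, for each type $t\in[K]$ and action $i\in[N]$, a probability distribution $(F^{(t)}_{i,j})_{j\in[m]}$ over outcomes. The agent's type is uniform on $[K]$; $\mathbb E_t$ denotes the expectation over it. A contract is a vector $\mathbf x\in\mathbb R_{\ge0}^m$. Under $\mathbf x$, an agent of type $t$ plays an action $i_*^{(t)}(\mathbf x)\in\arg\max_i\big(\sum_j F^{(t)}_{i,j}x_j-c_i\big)$, ties being broken so as to maximize the principal's profit $\mathrm{Profit}^{(t)}(\mathbf x)=\sum_j F^{(t)}_{i_*^{(t)}(\mathbf x),j}(r_j-x_j)$. A menu $X=(\mathbf x^{(1)},\dots,\mathbf x^{(K)})$ assigns one contract per type; it is incentive-compatible (IC) if for all $t,t'\in[K]$: $\max_i\big(\sum_jF^{(t)}_{i,j}x^{(t)}_j-c_i\big)\ge\max_i\big(\sum_jF^{(t)}_{i,j}x^{(t')}_j-c_i\big)$.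 $\mathrm{OptTypeAware}=\max\mathbb E_t[\mathrm{Profit}^{(t)}(\mathbf x^{(t)})]$ over all tuples $(\mathbf x^{(1)},\dots,\mathbf x^{(K)})$ of contracts; $\mathrm{OptMenu}$ is the same maximum restricted to IC menus. *)

theory Defs
  imports "HOL-Analysis.Analysis"
begin

text \<open>
  Types, actions and outcomes are indexed by initial segments of the naturals. Values of
  the component functions outside these ranges play no role.
\<close>

record principal_agent =
  num_types :: nat
  num_actions :: nat
  num_outcomes :: nat
  cost :: "nat \<Rightarrow> real"
  outcome_prob :: "nat \<Rightarrow> nat \<Rightarrow> nat \<Rightarrow> real"  \<comment> \<open>type, action, outcome\<close>
  reward :: "nat \<Rightarrow> real"

definition principal_agent_problem :: "principal_agent \<Rightarrow> bool" where
  "principal_agent_problem P \<longleftrightarrow>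
     num_types P \<ge> 1 \<and>
     (\<forall>i < num_actions P. cost P i \<ge> 0) \<and>
     (\<exists>i < num_actions P. cost P i = 0) \<and>
     (\<forall>j < num_outcomes P. reward P j \<ge> 0) \<and>
     (\<exists>j < num_outcomes P. reward P j = 0) \<and>
     (\<forall>t < num_types P. \<forall>i < num_actions P.
        (\<forall>j < num_outcomes P. outcome_prob P t i j \<ge> 0) \<and>
        (\<Sum>j < num_outcomes P. outcome_prob P t i j) = 1)"

definition contract :: "principal_agent \<Rightarrow> (nat \<Rightarrow> real) \<Rightarrow> bool" where
  "contract P x \<longleftrightarrow> (\<forall>j < num_outcomes P. x j \<ge> 0)"

definition agent_utility :: "principal_agent \<Rightarrow> nat \<Rightarrow> (nat \<Rightarrow> real) \<Rightarrow> nat \<Rightarrow> real" where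
  "agent_utility P t x i = (\<Sum>j < num_outcomes P. outcome_prob P t i j * x j) - cost P i"

definition principal_utility :: "principal_agent \<Rightarrow> nat \<Rightarrow> (nat \<Rightarrow> real) \<Rightarrow> nat \<Rightarrow> real" where
  "principal_utility P t x i = (\<Sum>j < num_outcomes P. outcome_prob P t i j * (reward P j - x j))"

definition best_responses :: "principal_agent \<Rightarrow> nat \<Rightarrow> (nat \<Rightarrow> real) \<Rightarrow> nat set" where
  "best_responses P t x = {i. is_arg_max (agent_utility P t x) (\<lambda>i. i < num_actions P) i}"

text \<open>
  Actions that remain tied after breaking ties in the principal's favour give the same
  profit, so the arbitrary choice made by \<^term>\<open>arg_max_on\<close> among them does not affect
  the profit.
\<close>

definition induced_action :: "principal_agent \<Rightarrow> nat \<Rightarrow> (nat \<Rightarrow> real) \<Rightarrow> nat" where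
  "induced_action P t x = arg_max_on (principal_utility P t x) (best_responses P t x)"

definition profit :: "principal_agent \<Rightarrow> nat \<Rightarrow> (nat \<Rightarrow> real) \<Rightarrow> real" where
  "profit P t x = principal_utility P t x (induced_action P t x)"

definition menu :: "principal_agent \<Rightarrow> (nat \<Rightarrow> nat \<Rightarrow> real) \<Rightarrow> bool" where
  "menu P X \<longleftrightarrow> (\<forall>t < num_types P. contract P (X t))"

definition max_agent_utility :: "principal_agent \<Rightarrow> nat \<Rightarrow> (nat \<Rightarrow> real) \<Rightarrow> real" where
  "max_agent_utility P t x = Max (agent_utility P t x ` {..<num_actions P})"

definition incentive_compatible :: "principal_agent \<Rightarrow> (nat \<Rightarrow> nat \<Rightarrow> real) \<Rightarrow> bool" where
  "incentive_compatible P X \<longleftrightarrow>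
     (\<forall>t < num_types P. \<forall>t' < num_types P.
        max_agent_utility P t (X t) \<ge> max_agent_utility P t (X t'))"

definition expected_profit :: "principal_agent \<Rightarrow> (nat \<Rightarrow> nat \<Rightarrow> real) \<Rightarrow> real" where
  "expected_profit P X = (\<Sum>t < num_types P. profit P t (X t)) / real (num_types P)"

text \<open>
  For a principal-agent problem, both suprema below are over nonempty sets (the zero menu
  is incentive-compatible) bounded above by the largest reward. They are in fact maxima:
  for a fixed profile of best responses, the admissible menus form a polyhedron on which
  the expected profit is linear and bounded above, and there are finitely many profiles.
\<close>

definition opt_type_aware :: "principal_agent \<Rightarrow> real" where
  "opt_type_aware P = (SUP X \<in> {X. menu P X}. expected_profit P X)"

definition opt_menu :: "principal_agent \<Rightarrow> real" where
  "opt_menu P = (SUP X \<in> {X. menu P X \<and> incentive_compatible P X}. expected_profit P X)"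

end

theory Submission
  imports Defs
begin

text \<open>
  Up to a common scaling factor, action \<open>i\<close> costs \<open>T + T\<^sup>2 + \<dots> + T\<^sup>i\<close>, and the
  success probabilities are such that the \<open>t\<close>-th type, \<open>1 \<le> t \<le> T\<close>, moves up to action \<open>i\<close>
  once a success (worth 1) is paid \<open>1 - 1 / (t T\<^sup>i)\<close>. The aggregate success probability at
  payment \<open>1 - d\<close> is then \<open>O(1 / d)\<close>, so paying for success alone earns \<open>O(1)\<close>, while the total
  welfare is at least the sum of \<open>n / t\<close> over all \<open>t\<close>, hence at least \<open>n ln T\<close>.
  With a very small probability action \<open>n\<close> produces a signal. A type-aware principal extracts
  the welfare by paying for the signal only. An additional type, whose outcome is always the
  signal and who is worthless to the principal, can claim any such payment from a menu and
  thereby makes it unprofitable.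
\<close>

lemma best_responses_iff:
  "i \<in> best_responses P t x \<longleftrightarrow>
    i < num_actions P \<and> (\<forall>j < num_actions P. agent_utility P t x j \<le> agent_utility P t x i)"
  by (auto simp: best_responses_def is_arg_max_linorder)

lemma best_responses_nonempty:
  assumes "num_actions P > 0"
  shows "best_responses P t x \<noteq> {}"
proof -
  let ?U = "agent_utility P t x ` {..<num_actions P}"
  have "Max ?U \<in> ?U"
    using assms by (intro Max_in) auto
  then obtain i where "i < num_actions P" "agent_utility P t x i = Max ?U"
    by auto
  then have "i \<in> best_responses P t x"
    by (simp add: best_responses_iff)
  then show ?thesis by blast
qed

text \<open>\<open>arg_max_on\<close> is a choice operator, so maximality of its value rests on the
  existence of a maximizer, which comes from finiteness and nonemptiness of the set of best
  responses.\<close>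

lemma is_arg_max_induced_action:
  assumes "num_actions P > 0"
  shows "is_arg_max (principal_utility P t x) (\<lambda>i. i \<in> best_responses P t x) (induced_action P t x)"
proof -
  let ?B = "best_responses P t x"
  let ?V = "principal_utility P t x ` ?B"
  have "finite ?B"
    by (rule finite_subset[of _ "{..<num_actions P}"]) (auto simp: best_responses_iff)
  then have "Max ?V \<in> ?V" "\<forall>v\<in>?V. v \<le> Max ?V"
    using best_responses_nonempty[OF assms] by auto
  then obtain i where "i \<in> ?B" "\<forall>j\<in>?B. principal_utility P t x j \<le> principal_utility P t x i"
    by auto
  then have "is_arg_max (principal_utility P t x) (\<lambda>i. i \<in> ?B) i"
    by (simp add: is_arg_max_linorder)
  then show ?thesis
    unfolding induced_action_def arg_max_on_def arg_max_def by (rule someI)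
qed

lemma induced_action_best_response:
  "num_actions P > 0 \<Longrightarrow> induced_action P t x \<in> best_responses P t x"
  using is_arg_max_induced_action by (simp add: is_arg_max_linorder)

lemma profit_ge_best_response:
  "i \<in> best_responses P t x \<Longrightarrow> principal_utility P t x i \<le> profit P t x"
  using is_arg_max_induced_action[of P t x]
  by (auto simp: is_arg_max_linorder profit_def best_responses_iff)

lemma agent_utility_le_max:
  "i < num_actions P \<Longrightarrow> agent_utility P t x i \<le> max_agent_utility P t x"
  by (simp add: max_agent_utility_def)

lemma max_agent_utility_best_response:
  "i \<in> best_responses P t x \<Longrightarrow> max_agent_utility P t x = agent_utility P t x i"
  unfolding max_agent_utility_def best_responses_iff by (intro Max_eqI) auto

text \<open>Payments are mere transfers and cancel. Lower bounds on an agent's utility, such as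
  those from incentive compatibility, thereby become upper bounds on profit.\<close>

lemma profit_eq_welfare_minus_utility:
  fixes P t x
  defines "i \<equiv> induced_action P t x"
  assumes "num_actions P > 0"
  shows "profit P t x =
    (\<Sum>j < num_outcomes P. outcome_prob P t i j * reward P j) - cost P i - max_agent_utility P t x"
proof -
  have "max_agent_utility P t x = agent_utility P t x i"
    using induced_action_best_response[OF assms(2)] max_agent_utility_best_response
    unfolding i_def by blast
  then show ?thesis
    by (simp add: profit_def i_def principal_utility_def agent_utility_def right_diff_distrib sum_subtractf)
qed

section \<open>Harmonic sums and sums of powers\<close>

lemma sum_lessThan_4: "(\<Sum>j<4. f j) = f 0 + f 1 + f 2 + f (3::nat)" for f :: "nat \<Rightarrow> real"
  by (simp add: eval_nat_numeral)

lemma ln_le_sum_inverse: "T \<ge> 1 \<Longrightarrow> ln (real T) \<le> (\<Sum>t<T. 1 / real (Suc t))"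
proof -
  assume "T \<ge> 1"
  then have "ln (real T) \<le> ln (real T + 1)" by simp
  also have "\<dots> \<le> harm T" by (rule ln_le_harm)
  also have "harm T = (\<Sum>t<T. 1 / real (Suc t))"
    unfolding harm_def by (simp add: inverse_eq_divide sum.atLeast1_atMost_eq)
  finally show ?thesis .
qed

text \<open>
  The types whose power is the maximum \<open>M\<close> number at most \<open>N / M\<close>, and all others
  contribute at most \<open>M / T\<close> each, so both groups sum to at most \<open>N\<close>.
\<close>

lemma sum_powers_le:
  fixes T :: nat and N :: real and e :: "nat \<Rightarrow> nat"
  assumes "T \<ge> 1" "A \<subseteq> {..<T}"
    and le: "\<And>t. t \<in> A \<Longrightarrow> real (Suc t) * real T ^ e t \<le> N"
    and "N \<ge> 0"
  shows "(\<Sum>t\<in>A. real T ^ e t) \<le> 2 * N"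
proof (cases "A = {}")
  case False
  have fin: "finite A" using assms(2) finite_subset by blast
  define k where "k = Max (e ` A)"
  define M where "M = real T ^ k"
  have M: "M > 0" using assms(1) by (simp add: M_def)
  have "k \<in> e ` A" unfolding k_def using fin False by (intro Max_in) auto
  then obtain t0 where t0: "t0 \<in> A" "e t0 = k" by auto
  \<comment> \<open>The lower powers sum to at most \<open>M\<close> below; the constraint at a type
    attaining the maximum replaces this by \<open>N\<close>.\<close>
  have MN: "M \<le> N"
  proof -
    have "M \<le> real (Suc t0) * M" using M by (simp add: mult_le_cancel_right1)
    then show ?thesis using le[OF t0(1)] t0(2) by (simp add: M_def)
  qed
  let ?H = "{t\<in>A. e t = k}" and ?L = "{t\<in>A. e t \<noteq> k}"
  have "?H \<subseteq> {..<nat \<lfloor>N / M\<rfloor>}"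
  proof
    fix t assume "t \<in> ?H"
    then have "real (Suc t) \<le> N / M"
      using le[of t] M by (simp add: M_def pos_le_divide_eq)
    then have "Suc t \<le> nat \<lfloor>N / M\<rfloor>" using le_nat_floor by blast
    then show "t \<in> {..<nat \<lfloor>N / M\<rfloor>}" by simp
  qed
  then have "card ?H \<le> nat \<lfloor>N / M\<rfloor>"
    using card_mono[of "{..<nat \<lfloor>N / M\<rfloor>}" ?H] by simp
  then have "real (card ?H) \<le> N / M"
    using M \<open>N \<ge> 0\<close> by (simp add: le_nat_iff le_floor_iff)
  then have H: "(\<Sum>t\<in>?H. real T ^ e t) \<le> N"
    using M by (simp add: M_def[symmetric] pos_le_divide_eq)
  have "(\<Sum>t\<in>?L. real T ^ e t) \<le> (\<Sum>t\<in>?L. M / T)"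
  proof (rule sum_mono)
    fix t assume t: "t \<in> ?L"
    then have "e t \<le> k" unfolding k_def using fin by simp
    with t have "Suc (e t) \<le> k" by simp
    then have "real T ^ Suc (e t) \<le> M"
      unfolding M_def using assms(1) by (intro power_increasing) auto
    then show "real T ^ e t \<le> M / T" using assms(1) by (simp add: field_simps)
  qed
  also have "\<dots> = card ?L * (M / T)" by simp
  also have "\<dots> \<le> T * (M / T)"
  proof (rule mult_right_mono)
    have "card ?L \<le> card {..<T}" using assms(2) by (intro card_mono) auto
    then show "real (card ?L) \<le> real T" by simp
  qed (use M in simp)
  also have "\<dots> = M" using assms(1) by simp
  finally have L: "(\<Sum>t\<in>?L. real T ^ e t) \<le> N" using MN by simp
  have "(\<Sum>t\<in>A. real T ^ e t) = (\<Sum>t\<in>?H. real T ^ e t) + (\<Sum>t\<in>?L. real T ^ e t)"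
    using fin by (subst sum.union_disjoint[symmetric]) (auto intro: sum.cong)
  then show ?thesis using H L by simp
qed (use assms in simp)

section \<open>The instance and its probabilities\<close>

locale gap_instance =
  fixes n T :: nat
  assumes n: "n \<ge> 1" and T: "T \<ge> 2"
begin

text \<open>Small enough to keep every success probability at most 1/2, which leaves room for the
  signal.\<close>

definition \<eta> :: real where "\<eta> = 1 / (8 * real T ^ n)"

text \<open>A signal payment of \<open>T\<close> is then worth only \<open>\<eta> / T\<close> in
  expectation, a lower bound for the slack \<open>q * margin t i\<close> in
  \<open>incentive_le_margin\<close>.\<close>

definition \<epsilon> :: real where "\<epsilon> = \<eta> / real T ^ 2"

text \<open>The regular types are indexed from 0 and weighted by \<open>Suc t\<close>; index
  \<open>T\<close> is left for the additional type.\<close>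

definition margin :: "nat \<Rightarrow> nat \<Rightarrow> real" where
  "margin t k = 1 / (real (Suc t) * real T ^ k)"

definition effort_cost :: "nat \<Rightarrow> real" where
  "effort_cost i = \<eta> * (\<Sum>k=1..i. real T ^ k)"

text \<open>
  Chosen such that type \<open>t\<close> switches from action \<open>k - 1\<close> to action \<open>k\<close> when the payment
  for success reaches \<open>1 - margin t k\<close>.
\<close>

definition success_prob :: "nat \<Rightarrow> nat \<Rightarrow> real" where
  "success_prob t i = \<eta> * (\<Sum>k=1..i. real T ^ k / (1 - margin t k))"

definition signal_prob :: "nat \<Rightarrow> real" where
  "signal_prob i = (if i = n then \<epsilon> else 0)"

text \<open>
  Outcome 0 is failure, 1 is success, 2 is the signal and 3 never occurs.
\<close>

definition problem :: principal_agent where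
  "problem = \<lparr>
     num_types = T + 1,
     num_actions = n + 1,
     num_outcomes = 4,
     cost = effort_cost,
     outcome_prob = (\<lambda>t i j.
       if t = T then (if j = 2 then 1 else 0)
       else if j = 0 then 1 - success_prob t i - signal_prob i
       else if j = 1 then success_prob t i
       else if j = 2 then signal_prob i
       else 0),
     reward = (\<lambda>j. if j = 1 then 1 else 0)\<rparr>"

lemma problem_simps [simp]:
  "num_types problem = T + 1" "num_actions problem = n + 1" "num_outcomes problem = 4"
  "cost problem = effort_cost"
  by (simp_all add: problem_def)

lemma eta_pos: "\<eta> > 0"
  using T by (simp add: \<eta>_def)

lemma eps_pos: "\<epsilon> > 0"
  using T eta_pos by (simp add: \<epsilon>_def)

lemma margin_pos: "margin t k > 0"
  using T by (simp add: margin_def)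

lemma margin_le_half:
  assumes "k \<ge> 1"
  shows "margin t k \<le> 1 / 2"
proof -
  have "2 \<le> real T ^ 1" using T by simp
  also have "\<dots> \<le> real T ^ k" using T assms by (intro power_increasing) auto
  also have "\<dots> \<le> real (Suc t) * real T ^ k" using T by (simp add: mult_le_cancel_right1)
  finally show ?thesis unfolding margin_def by (intro divide_left_mono) auto
qed

lemma sum_powers_le_double: "(\<Sum>k=1..i. real T ^ k) \<le> 2 * real T ^ i"
proof (induction i)
  case (Suc i)
  have "2 * real T ^ i \<le> real T ^ Suc i" using T by (simp add: mult_right_mono)
  then show ?case using Suc by simp
qed simp

lemma effort_cost_nonneg: "effort_cost i \<ge> 0"
  using eta_pos by (simp add: effort_cost_def sum_nonneg)

lemma success_prob_nonneg: "success_prob t i \<ge> 0"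
  unfolding success_prob_def
proof (intro mult_nonneg_nonneg sum_nonneg divide_nonneg_nonneg)
  show "0 \<le> 1 - margin t k" if "k \<in> {1..i}" for k
    using margin_le_half[of k t] that by simp
qed (use eta_pos in auto)

text \<open>One factor 2 comes from dividing by \<open>1 - margin t k\<close>, which is at least
  1/2, another from the geometric sum of ratio at least 2.\<close>

lemma success_prob_le: "success_prob t i \<le> 4 * \<eta> * real T ^ i"
proof -
  have "success_prob t i \<le> \<eta> * (\<Sum>k=1..i. 2 * real T ^ k)"
    unfolding success_prob_def
  proof (intro mult_left_mono sum_mono)
    fix k assume k: "k \<in> {1..i}"
    have "1 / 2 \<le> 1 - margin t k" using margin_le_half[of k t] k by auto
    then have "real T ^ k / (1 - margin t k) \<le> real T ^ k / (1 / 2)"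
      by (intro divide_left_mono) auto
    then show "real T ^ k / (1 - margin t k) \<le> 2 * real T ^ k" by simp
  qed (use eta_pos in simp)
  also have "\<dots> = 2 * \<eta> * (\<Sum>k=1..i. real T ^ k)"
    by (simp add: sum_distrib_left mult.assoc mult.left_commute)
  also have "\<dots> \<le> 2 * \<eta> * (2 * real T ^ i)"
    using eta_pos by (intro mult_left_mono sum_powers_le_double) auto
  finally show ?thesis by simp
qed

lemma success_prob_le_half:
  assumes "i \<le> n"
  shows "success_prob t i \<le> 1 / 2"
proof -
  have "4 * \<eta> * real T ^ i \<le> 4 * \<eta> * real T ^ n"
    using assms eta_pos T by (intro mult_left_mono power_increasing) auto
  also have "\<dots> = 1 / 2" using T by (simp add: \<eta>_def)
  finally show ?thesis using success_prob_le[of t i] by linarith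
qed

lemma eps_le_half: "\<epsilon> \<le> 1 / 2"
proof -
  have pow: "1 \<le> real T ^ k" for k using T by (intro one_le_power) simp
  have "\<eta> \<le> 1 / 8"
    using pow[of n] by (simp add: \<eta>_def divide_le_eq)
  moreover have "\<epsilon> \<le> \<eta> / 1"
    unfolding \<epsilon>_def using pow[of 2] eta_pos T by (intro divide_left_mono) auto
  ultimately show ?thesis by linarith
qed

lemma signal_prob_bounds: "0 \<le> signal_prob i" "signal_prob i \<le> 1 / 2"
  using eps_pos eps_le_half by (auto simp: signal_prob_def)

lemma principal_agent_problem: "principal_agent_problem problem"
  unfolding principal_agent_problem_def
proof (intro conjI allI impI)
  show "\<exists>i<num_actions problem. cost problem i = 0"
    by (rule exI[of _ 0]) (simp add: effort_cost_def)
  show "\<exists>j<num_outcomes problem. reward problem j = 0"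
    by (rule exI[of _ 0]) (simp add: problem_def)
next
  fix t i assume "i < num_actions problem"
  then have "success_prob t i \<le> 1 / 2" by (intro success_prob_le_half) simp
  then show "0 \<le> outcome_prob problem t i j" for j
    using success_prob_nonneg[of t i] signal_prob_bounds[of i]
    by (auto simp: problem_def)
  show "(\<Sum>j<num_outcomes problem. outcome_prob problem t i j) = 1"
    by (simp only: problem_simps sum_lessThan_4) (simp add: problem_def)
qed (auto simp: effort_cost_nonneg problem_def)

section \<open>Utilities and profits in the instance\<close>

lemma agent_utility_regular:
  assumes "t < T"
  shows "agent_utility problem t x i =
    x 0 + success_prob t i * (x 1 - x 0) + signal_prob i * (x 2 - x 0) - effort_cost i"
  using assms unfolding agent_utility_def problem_simps sum_lessThan_4
  by (simp add: problem_def algebra_simps)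

lemma agent_utility_extra: "agent_utility problem T x i = x 2 - effort_cost i"
  unfolding agent_utility_def problem_simps sum_lessThan_4 by (simp add: problem_def)

lemma principal_utility_regular:
  assumes "t < T"
  shows "principal_utility problem t x i =
    success_prob t i * (1 - x 1) - (1 - success_prob t i - signal_prob i) * x 0 - signal_prob i * x 2"
  using assms unfolding principal_utility_def problem_simps sum_lessThan_4
  by (simp add: problem_def algebra_simps)

lemma profit_extra: "profit problem T x = - x 2"
  unfolding profit_def principal_utility_def problem_simps sum_lessThan_4
  by (simp add: problem_def)

text \<open>Action 0 is free and the signal is certain. Incentive compatibility for type
  \<open>T\<close> thus says that no contract of the menu pays more for the signal than its
  own.\<close>

lemma max_agent_utility_extra: "max_agent_utility problem T x = x 2"
proof -
  have "0 \<in> best_responses problem T x"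
    using effort_cost_nonneg by (simp add: best_responses_iff agent_utility_extra effort_cost_def[of 0])
  then show ?thesis
    by (simp add: max_agent_utility_best_response agent_utility_extra effort_cost_def)
qed

lemma induced_action_best: "induced_action problem t x \<in> best_responses problem t x"
  by (rule induced_action_best_response) simp

lemma induced_action_le: "induced_action problem t x \<le> n"
  using induced_action_best[of t x] by (simp add: best_responses_iff)

lemma profit_le_1:
  assumes "contract problem x" "t \<le> T"
  shows "profit problem t x \<le> 1"
proof (cases "t = T")
  case True
  then show ?thesis
    using assms by (auto simp: profit_extra contract_def intro: order_trans[of _ 0])
next
  case False
  define i where "i = induced_action problem t x"
  have x: "x 0 \<ge> 0" "x 1 \<ge> 0" "x 2 \<ge> 0" using assms(1) by (auto simp: contract_def)
  have i: "success_prob t i \<le> 1 / 2"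
    unfolding i_def by (intro success_prob_le_half induced_action_le)
  have "success_prob t i * (1 - x 1) \<le> success_prob t i"
    using success_prob_nonneg[of t i] x by (simp add: mult_left_le)
  moreover have "0 \<le> (1 - success_prob t i - signal_prob i) * x 0"
    using i signal_prob_bounds[of i] x by simp
  moreover have "0 \<le> signal_prob i * x 2" using signal_prob_bounds[of i] x by simp
  ultimately show ?thesis
    using False assms i by (simp add: profit_def i_def[symmetric] principal_utility_regular)
qed

lemma expected_profit_le_1:
  assumes "menu problem X"
  shows "expected_profit problem X \<le> 1"
proof -
  have "(\<Sum>t < T + 1. profit problem t (X t)) \<le> (\<Sum>t < T + 1. 1)"
    using assms by (intro sum_mono profit_le_1) (auto simp: menu_def)
  then show ?thesis by (simp add: expected_profit_def)
qed

section \<open>Lower bound for the type-aware optimum\<close>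

lemma welfare_ge: "success_prob t n - effort_cost n \<ge> \<eta> * (real n / real (Suc t))"
proof -
  have "real n / real (Suc t) = (\<Sum>k=1..n. 1 / real (Suc t))" by simp
  also have "\<dots> \<le> (\<Sum>k=1..n. real T ^ k / (1 - margin t k) - real T ^ k)"
  proof (rule sum_mono)
    fix k assume k: "k \<in> {1..n}"
    have d: "0 < margin t k" "margin t k \<le> 1 / 2"
      using margin_pos margin_le_half[of k t] k by auto
    \<comment> \<open>The power of \<open>T\<close> cancels, so all \<open>n\<close> steps admit the
      same lower bound on their welfare gain.\<close>
    have "1 / real (Suc t) = real T ^ k * margin t k"
      using T by (simp add: margin_def)
    also have "\<dots> \<le> real T ^ k * margin t k / (1 - margin t k)"
      using d by (simp add: field_simps mult_left_mono)
    also have "\<dots> = real T ^ k / (1 - margin t k) - real T ^ k"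
      using d by (simp add: field_simps)
    finally show "1 / real (Suc t) \<le> real T ^ k / (1 - margin t k) - real T ^ k" .
  qed
  finally have "\<eta> * (real n / real (Suc t)) \<le>
      \<eta> * (\<Sum>k=1..n. real T ^ k / (1 - margin t k) - real T ^ k)"
    using eta_pos by (intro mult_left_mono) auto
  then show ?thesis
    by (simp add: success_prob_def effort_cost_def sum_subtractf right_diff_distrib)
qed

lemma opt_type_aware_ge: "opt_type_aware problem \<ge> \<eta> * real n * ln (real T) / (T + 1)"
proof -
  \<comment> \<open>The expected signal payment for action \<open>n\<close> is exactly its cost. The
    agent is left with utility 0, ties favour the principal, and the whole welfare is extracted. The
    additional type gets the zero contract.\<close>
  define X :: "nat \<Rightarrow> nat \<Rightarrow> real" where
    "X t j = (if t < T \<and> j = 2 then effort_cost n / \<epsilon> else 0)" for t j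
  have menu: "menu problem X"
    using effort_cost_nonneg eps_pos by (simp add: menu_def contract_def X_def)
  have "profit problem t (X t) \<ge> \<eta> * (real n / real (Suc t))" if t: "t < T" for t
  proof -
    have "n \<in> best_responses problem t (X t)"
      using t eps_pos effort_cost_nonneg
      by (auto simp: best_responses_iff agent_utility_regular X_def signal_prob_def)
    from profit_ge_best_response[OF this] welfare_ge[of t] show ?thesis
      using t eps_pos by (simp add: principal_utility_regular X_def signal_prob_def)
  qed
  then have "(\<Sum>t<T. \<eta> * (real n / real (Suc t))) \<le> (\<Sum>t<T. profit problem t (X t))"
    by (intro sum_mono) simp
  moreover have "(\<Sum>t<T. \<eta> * (real n / real (Suc t))) = \<eta> * real n * (\<Sum>t<T. 1 / real (Suc t))"
    by (simp add: sum_distrib_left)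
  moreover have "\<eta> * real n * ln (real T) \<le> \<eta> * real n * (\<Sum>t<T. 1 / real (Suc t))"
    using eta_pos T by (intro mult_left_mono ln_le_sum_inverse) auto
  moreover have "profit problem T (X T) = 0" by (simp add: profit_extra X_def)
  ultimately have "\<eta> * real n * ln (real T) \<le> (\<Sum>t<T + 1. profit problem t (X t))"
    by simp
  then have "\<eta> * real n * ln (real T) / (T + 1) \<le> expected_profit problem X"
    by (simp add: expected_profit_def divide_right_mono)
  also have "\<dots> \<le> opt_type_aware problem"
    unfolding opt_type_aware_def
    using menu expected_profit_le_1 by (intro cSUP_upper bdd_aboveI2) auto
  finally show ?thesis .
qed

section \<open>Upper bound for incentive-compatible menus\<close>

text \<open>
  Since \<open>\<epsilon>\<close> is tiny, a signal payment of at most \<open>T\<close> moves the switching points only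
  slightly.
\<close>

lemma incentive_le_margin:
  assumes "t < T" "contract problem x" "x 2 \<le> T"
    and i: "i \<in> best_responses problem t x" "i \<ge> 1"
  shows "1 - (x 1 - x 0) \<le> 2 * margin t i"
proof -
  \<comment> \<open>The gain in success probability from action \<open>i - 1\<close> to
    \<open>i\<close>. This step costs \<open>q * (1 - margin t i)\<close>, so only an incentive from
    the signal can lower the switching point.\<close>
  define q where "q = \<eta> * (real T ^ i / (1 - margin t i))"
  obtain k where k: "i = Suc k" using i(2) by (cases i) auto
  have x: "x 0 \<ge> 0" "x 2 \<ge> 0" using assms(2) by (auto simp: contract_def)
  have d: "0 < margin t i" "margin t i \<le> 1 / 2"
    using margin_pos margin_le_half[of i t] i(2) by auto
  have q: "q > 0" using eta_pos d T by (simp add: q_def)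
  have q_margin: "q * margin t i \<ge> \<eta> / T"
  proof -
    have "\<eta> / T \<le> \<eta> / real (Suc t)"
      using assms(1) eta_pos by (intro divide_left_mono) auto
    also have "\<dots> = \<eta> * real T ^ i * margin t i"
      using T by (simp add: margin_def)
    also have "\<dots> \<le> q * margin t i"
      using d T eta_pos by (intro mult_right_mono) (auto simp: q_def field_simps)
    finally show ?thesis .
  qed
  have "agent_utility problem t x k \<le> agent_utility problem t x i"
    using i k by (simp add: best_responses_iff)
  moreover have "success_prob t i = success_prob t k + q"
    by (simp add: success_prob_def q_def k distrib_left)
  moreover have "effort_cost i = effort_cost k + \<eta> * real T ^ i"
    by (simp add: effort_cost_def k distrib_left)
  \<comment> \<open>Here \<open>k < n\<close>, and only action \<open>n\<close> can produce the
    signal.\<close>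
  moreover have "signal_prob k = 0"
    using i k by (simp add: signal_prob_def best_responses_iff)
  ultimately have "\<eta> * real T ^ i \<le> q * (x 1 - x 0) + signal_prob i * (x 2 - x 0)"
    using assms(1) by (simp add: agent_utility_regular algebra_simps)
  moreover have "\<eta> * real T ^ i = q * (1 - margin t i)"
    using d by (simp add: q_def)
  moreover have "signal_prob i * (x 2 - x 0) \<le> q * margin t i"
  proof -
    have "signal_prob i * (x 2 - x 0) \<le> signal_prob i * T"
      using signal_prob_bounds[of i] assms(3) x by (intro mult_left_mono) auto
    also have "\<dots> \<le> \<epsilon> * T"
      using eps_pos by (auto simp: signal_prob_def)
    also have "\<dots> = \<eta> / T" using T by (simp add: \<epsilon>_def power2_eq_square)
    finally show ?thesis using q_margin by linarith
  qed
  ultimately have "q * (1 - (x 1 - x 0)) \<le> q * (2 * margin t i)"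
    by (simp add: algebra_simps)
  then show ?thesis using q by simp
qed

text \<open>Type \<open>t\<close> could take the contract \<open>X m\<close> and still play
  \<open>i\<close>. Since \<open>X m 0\<close> and \<open>X m 2\<close> are nonnegative, this
  guarantees a utility that, subtracted from the welfare of \<open>i\<close>, leaves the
  bound.\<close>

lemma profit_le_incentive:
  assumes "menu problem X" "incentive_compatible problem X" "t < T" "m \<le> T"
  defines "i \<equiv> induced_action problem t (X t)"
  shows "profit problem t (X t) \<le> success_prob t i * (1 - (X m 1 - X m 0))"
proof -
  have i: "i \<le> n" unfolding i_def by (rule induced_action_le)
  have x: "X m 0 \<ge> 0" "X m 2 \<ge> 0" using assms(1,4) by (auto simp: menu_def contract_def)
  have "success_prob t i * (X m 1 - X m 0) - effort_cost i \<le> agent_utility problem t (X m) i"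
  proof -
    have "0 \<le> (1 - signal_prob i) * X m 0 + signal_prob i * X m 2"
      using signal_prob_bounds[of i] x by simp
    then show ?thesis using assms(3) by (simp add: agent_utility_regular algebra_simps)
  qed
  also have "\<dots> \<le> max_agent_utility problem t (X m)"
    using i by (intro agent_utility_le_max) simp
  also have "\<dots> \<le> max_agent_utility problem t (X t)"
    using assms(2-4) by (simp add: incentive_compatible_def)
  finally have U: "success_prob t i * (X m 1 - X m 0) - effort_cost i
      \<le> max_agent_utility problem t (X t)" .
  have "(\<Sum>j < num_outcomes problem. outcome_prob problem t i j * reward problem j) = success_prob t i"
    unfolding problem_simps sum_lessThan_4 using assms(3) by (simp add: problem_def)
  then have "profit problem t (X t) = success_prob t i - effort_cost i - max_agent_utility problem t (X t)"
    using profit_eq_welfare_minus_utility[of problem t "X t"] by (simp add: i_def)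
  with U show ?thesis by (simp add: algebra_simps)
qed

lemma sum_profit_le:
  assumes X: "menu problem X" "incentive_compatible problem X"
  shows "(\<Sum>t < T + 1. profit problem t (X t)) \<le> 16 * \<eta>"
proof (cases "X T 2 > T")
  case True
  \<comment> \<open>The additional type costs more than \<open>T\<close>, while the \<open>T\<close>
    regular types earn at most 1 each.\<close>
  have "(\<Sum>t<T. profit problem t (X t)) \<le> (\<Sum>t<T. 1)"
    using X by (intro sum_mono profit_le_1) (auto simp: menu_def)
  then show ?thesis using True eta_pos by (simp add: profit_extra)
next
  case False
  have signal: "X t 2 \<le> T" if "t < T" for t
  proof -
    have "max_agent_utility problem T (X t) \<le> max_agent_utility problem T (X T)"
      using X(2) that by (simp add: incentive_compatible_def)
    then show ?thesis using False by (simp add: max_agent_utility_extra)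
  qed
  have extra: "profit problem T (X T) \<le> 0"
    using X(1) by (auto simp: profit_extra menu_def contract_def)
  define f where "f t = X t 1 - X t 0" for t
  \<comment> \<open>The contract with the strongest success incentive serves as the common
    deviation: it gives one factor \<open>D\<close> bounding all profits, and \<open>D\<close> is at
    most \<open>1 - f t\<close> for each regular type.\<close>
  have "Max (f ` {..<T}) \<in> f ` {..<T}"
    using T by (intro Max_in) (auto simp: lessThan_empty_iff)
  then obtain m where m: "m < T" "f m = Max (f ` {..<T})" by auto
  then have f_le: "f t \<le> f m" if "t < T" for t
    using that by simp
  define D where "D = 1 - f m"
  define e where "e t = induced_action problem t (X t)" for t
  have profit: "profit problem t (X t) \<le> success_prob t (e t) * D" if "t < T" for t
    using profit_le_incentive[OF X that, of m] m(1) by (simp add: D_def f_def e_def)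
  have "(\<Sum>t<T. profit problem t (X t)) \<le> 16 * \<eta>"
  proof (cases "D \<le> 0")
    case True
    then have "profit problem t (X t) \<le> 0" if "t < T" for t
      using profit[OF that] success_prob_nonneg[of t "e t"] mult_nonneg_nonpos order_trans by blast
    then have "(\<Sum>t<T. profit problem t (X t)) \<le> 0" by (intro sum_nonpos) simp
    then show ?thesis using eta_pos by simp
  next
    case False
    then have D: "D > 0" by simp
    let ?A = "{t. t < T \<and> e t \<ge> 1}"
    \<comment> \<open>The bound \<open>N\<close> is \<open>2 / D\<close>, with 2 from the doubled
      margin. The factor \<open>D\<close> in the profits cancels it, and 16 arises as 4 (from
      \<open>success_prob_le\<close>) times 2 times 2.\<close>
    have "(\<Sum>t\<in>?A. real T ^ e t) \<le> 2 * (2 / D)"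
    proof (rule sum_powers_le)
      fix t assume t: "t \<in> ?A"
      then have "D \<le> 1 - f t" using f_le by (simp add: D_def)
      also have "\<dots> \<le> 2 * margin t (e t)"
        using t X(1) signal unfolding f_def
        by (intro incentive_le_margin) (auto simp: e_def menu_def induced_action_best)
      finally show "real (Suc t) * real T ^ e t \<le> 2 / D"
        using D T by (simp add: margin_def field_simps del: of_nat_Suc)
    qed (use T D in auto)
    then have A: "4 * \<eta> * D * (\<Sum>t\<in>?A. real T ^ e t) \<le> 16 * \<eta>"
      using D eta_pos by (simp add: field_simps)
    have "(\<Sum>t<T. profit problem t (X t)) \<le> (\<Sum>t<T. success_prob t (e t) * D)"
      by (intro sum_mono profit) simp
    \<comment> \<open>Types playing action 0 never succeed and drop out.\<close>
    also have "\<dots> = (\<Sum>t\<in>?A. success_prob t (e t) * D)"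
      by (rule sum.mono_neutral_right) (auto simp: success_prob_def not_le)
    also have "\<dots> \<le> (\<Sum>t\<in>?A. 4 * \<eta> * real T ^ e t * D)"
      using D by (intro sum_mono mult_right_mono success_prob_le) auto
    also have "\<dots> = 4 * \<eta> * D * (\<Sum>t\<in>?A. real T ^ e t)"
      by (simp add: sum_distrib_left mult_ac)
    finally show ?thesis using A by linarith
  qed
  then show ?thesis using extra by simp
qed

lemma opt_menu_le: "opt_menu problem \<le> 16 * \<eta> / (T + 1)"
  unfolding opt_menu_def
proof (rule cSUP_least)
  have "(\<lambda>_ _. 0) \<in> {X. menu problem X \<and> incentive_compatible problem X}"
    by (simp add: menu_def contract_def incentive_compatible_def)
  then show "{X. menu problem X \<and> incentive_compatible problem X} \<noteq> {}" by blast
next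
  fix X assume "X \<in> {X. menu problem X \<and> incentive_compatible problem X}"
  then show "expected_profit problem X \<le> 16 * \<eta> / (T + 1)"
    using sum_profit_le[of X] by (simp add: expected_profit_def divide_right_mono)
qed

section \<open>Comparison of the two optima\<close>

lemma opt_type_aware_pos: "opt_type_aware problem > 0"
proof -
  have "0 < \<eta> * real n * ln (real T) / (T + 1)"
    using eta_pos n T by simp
  then show ?thesis using opt_type_aware_ge by linarith
qed

lemma opt_menu_le_opt_type_aware:
  "opt_menu problem \<le> 16 / (real n * ln (real T)) * opt_type_aware problem"
proof -
  have pos: "real n * ln (real T) > 0" using n T by simp
  have "opt_menu problem \<le> 16 * \<eta> / (T + 1)" by (rule opt_menu_le)
  \<comment> \<open>The scale \<open>\<eta> / (T + 1)\<close> is common to both bounds, so only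
    \<open>n * ln T\<close> against 16 remains.\<close>
  also have "\<dots> = 16 / (real n * ln (real T)) * (\<eta> * real n * ln (real T) / (T + 1))"
    using n T by simp
  also have "\<dots> \<le> 16 / (real n * ln (real T)) * opt_type_aware problem"
    using pos by (intro mult_left_mono opt_type_aware_ge) simp
  finally show ?thesis .
qed

end

theorem corollary14:
  shows "\<exists>C::real. C > 0 \<and>
    (\<forall>n T :: nat. n \<ge> 1 \<longrightarrow> T \<ge> 2 \<longrightarrow>
      (\<exists>P :: principal_agent.
         principal_agent_problem P \<and>
         num_types P = T + 1 \<and> num_actions P = n + 1 \<and> num_outcomes P = 4 \<and>
         opt_type_aware P > 0 \<and>
         opt_menu P \<le> C / (real n * ln (real T)) * opt_type_aware P))"
proof (rule exI[of _ 16], intro conjI allI impI)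
  fix n T :: nat
  assume "n \<ge> 1" "T \<ge> 2"
  then interpret gap_instance n T by unfold_locales
  show "\<exists>P :: principal_agent.
         principal_agent_problem P \<and>
         num_types P = T + 1 \<and> num_actions P = n + 1 \<and> num_outcomes P = 4 \<and>
         opt_type_aware P > 0 \<and>
         opt_menu P \<le> 16 / (real n * ln (real T)) * opt_type_aware P"
    using principal_agent_problem opt_type_aware_pos opt_menu_le_opt_type_aware
    by (intro exI[of _ problem]) simp
qed simp

end
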